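(* Let $k>s$ be positive integers, let $A=A_{k,s}$ be the adjacency matrix of the digraph $D_{k,s}$, and for $n\ge1$ let $b_n^{(k,s)}$ be the number of vertices of $P_{n,k,s}$. Then, as formal power series, $$\sum_{n\geq 0} b_{n+1}^{(k,s)} x^n=\sum_{n\geq 0}\Bigl(\sum_{i,j=1}^k (A^n)_{ij}\Bigr)x^n=\frac{\sum_{i,j=1}^k(-1)^{i+j}Q_{i,j}(x)}{Q(x)},$$ where $Q(x)=\det(I-xA)$ and $Q_{i,j}(x)$ is the determinant of the matrix obtained from $I-xA$ by removing the $j$th row and the $i$th column.
   Context: For positive integers $n,k,s$ let $K=s(n-1)+k$ and let $e_0,\ldots,e_{K-1}$ be the standard basis of $\mathbb{R}^{K}$. For $0\le i\le n-1$ let $\lambda_i=\{si,si+1,\ldots,si+k-1\}$ and $\Delta_{\lambda_i}=\operatorname{conv}\{e_j: j\in\lambda_i\}$. Then $P_{n,k,s}=\sum_{i=0}^{n-1}\Delta_{\lambda_i}$ (Minkowski sum). For $k>s$, $D_{k,s}$ is the digraph with vertex set $\{0,\ldots,k-1\}$ containing all possible arcs (including loops) except the arcs $(s+i',j')$ with $i',j'\in\{0,\ldots,k-1-s\}$ and $i'\neq j'$. Its adjacency matrix $A_{k,s}=(a_{ij})_{i,j=1}^k$ has $a_{ij}=1$ if $(i-1,j-1)$ is an arc and $a_{ij}=0$ otherwise. *)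

theory Defs
  imports
    "HOL-Analysis.Analysis"
    "HOL-Analysis.Finite_Function_Topology"
    "HOL-Computational_Algebra.Polynomial_FPS"
    "Jordan_Normal_Form.Determinant"
    "Graph_Theory.Pair_Digraph"
begin

text \<open>
  The ambient dimension \<open>K = s (n - 1) + k\<close> varies with \<open>n\<close>, so all the polytopes are placed in the
  single real vector space \<open>nat \<Rightarrow>\<^sub>0 real\<close> of finitely supported sequences, with \<open>\<real>\<^sup>K\<close> being the
  subspace of sequences supported on \<open>{..<K}\<close> (see \<open>P_poly_subset\<close> below). Convex hulls, Minkowski
  sums and extreme points do not depend on the ambient space.
\<close>

definition e_vec :: "nat \<Rightarrow> (nat \<Rightarrow>\<^sub>0 real)" where
  "e_vec j = Poly_Mapping.single j 1"

definition lam :: "nat \<Rightarrow> nat \<Rightarrow> nat \<Rightarrow> nat set" where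
  "lam k s i = {s * i..<s * i + k}"

definition simplex_on :: "nat set \<Rightarrow> (nat \<Rightarrow>\<^sub>0 real) set" where
  "simplex_on L = convex hull (e_vec ` L)"

text \<open>The sum is the Minkowski sum, i.e. addition of sets from \<open>HOL-Library.Set_Algebras\<close>.\<close>

definition P_poly :: "nat \<Rightarrow> nat \<Rightarrow> nat \<Rightarrow> (nat \<Rightarrow>\<^sub>0 real) set" where
  "P_poly n k s = (\<Sum>i<n. simplex_on (lam k s i))"

definition num_vertices :: "nat \<Rightarrow> nat \<Rightarrow> nat \<Rightarrow> nat" where
  "num_vertices k s n = card {v. v extreme_point_of P_poly n k s}"

definition D_graph :: "nat \<Rightarrow> nat \<Rightarrow> nat pair_pre_digraph" where
  "D_graph k s =
    \<lparr> pverts = {0..<k},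
      parcs = {0..<k} \<times> {0..<k}
        - {(s + i', j') | i' j'. i' \<in> {0..<k - s} \<and> j' \<in> {0..<k - s} \<and> i' \<noteq> j'} \<rparr>"

text \<open>
  Rows and columns are indexed from 0, so they are numbered by the vertices themselves. Compared with
  indices from 1 this shifts both \<open>i\<close> and \<open>j\<close> by one, which leaves the signs \<open>(-1) ^ (i + j)\<close>
  unchanged.
\<close>

definition adjacency_mat :: "nat \<Rightarrow> nat \<Rightarrow> real mat" where
  "adjacency_mat k s = mat k k (\<lambda>(i, j). if (i, j) \<in> parcs (D_graph k s) then 1 else 0)"

definition I_minus_xA :: "nat \<Rightarrow> nat \<Rightarrow> real poly mat" where
  "I_minus_xA k s = 1\<^sub>m k - [:0, 1:] \<cdot>\<^sub>m map_mat (\<lambda>a. [:a:]) (adjacency_mat k s)"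

text \<open>
  \<open>Q(0) = 1\<close>, so the power series of \<open>Q\<close> is a unit and division by it is multiplication by its inverse.
\<close>

definition Q_poly :: "nat \<Rightarrow> nat \<Rightarrow> real poly" where
  "Q_poly k s = Determinant.det (I_minus_xA k s)"

text \<open>
  \<open>mat_delete M a b\<close> removes row \<open>a\<close> and column \<open>b\<close>; hence the swapped order of the indices.
\<close>

definition Q_minor :: "nat \<Rightarrow> nat \<Rightarrow> nat \<Rightarrow> nat \<Rightarrow> real poly" where
  "Q_minor k s i j = Determinant.det (mat_delete (I_minus_xA k s) j i)"

lemma P_poly_subset:
  "P_poly n k s \<subseteq> {x. Poly_Mapping.keys x \<subseteq> {..<s * (n - 1) + k}}"
proof -
  define W where "W = {x :: nat \<Rightarrow>\<^sub>0 real. Poly_Mapping.keys x \<subseteq> {..<s * (n - 1) + k}}"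
  have W: "x \<in> W \<longleftrightarrow> (\<forall>j \<ge> s * (n - 1) + k. Poly_Mapping.lookup x j = 0)" for x
    unfolding W_def by (auto simp: in_keys_iff subset_iff) (meson not_le)
  have scale: "Poly_Mapping.lookup (u *\<^sub>R x) j = u * Poly_Mapping.lookup x j"
    for u :: real and x :: "nat \<Rightarrow>\<^sub>0 real" and j
  proof -
    have "finite {i. u *\<^sub>R Poly_Mapping.lookup x i \<noteq> 0}"
      by (rule finite_subset[OF _ finite_keys[of x]]) (auto simp: in_keys_iff)
    then show ?thesis
      by (simp add: scaleR_poly_mapping_def)
  qed
  have conv: "convex W"
    unfolding convex_def by (simp add: W scale lookup_add)
  have sub: "simplex_on (lam k s i) \<subseteq> W" if "i < n" for i
  proof -
    have "s * i \<le> s * (n - 1)"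
      using that by (intro mult_le_mono2) linarith
    then have "lam k s i \<subseteq> {..<s * (n - 1) + k}"
      unfolding lam_def by (intro subsetI) (simp only: atLeastLessThan_iff lessThan_iff, linarith)
    then have "e_vec ` lam k s i \<subseteq> W"
      by (auto simp: W_def e_vec_def)
    with conv show ?thesis
      unfolding simplex_on_def by (simp add: hull_minimal)
  qed
  have "(\<Sum>i<m. simplex_on (lam k s i)) \<subseteq> W" if "m \<le> n" for m
    using that
  proof (induction m)
    case 0
    then show ?case by (simp add: W)
  next
    case (Suc m)
    then have "(\<Sum>i<m. simplex_on (lam k s i)) \<subseteq> W" "simplex_on (lam k s m) \<subseteq> W"
      using sub by auto
    then show ?case
      by (auto simp: set_plus_def subset_iff W lookup_add)
  qed
  then show ?thesis
    unfolding P_poly_def W_def by blast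
qed

end

theory Submission
  imports Defs
begin

text \<open>
  An extreme point of a Minkowski sum has a unique decomposition, and its summands are extreme points.
  So the vertices of \<open>P\<^bsub>n,k,s\<^esub>\<close> are sums of \<open>e\<^bsub>f i\<^esub>\<close> with \<open>f i \<in> \<lambda>\<^sub>i\<close>, and uniqueness forbids that
  \<open>f i\<close> and \<open>f (i + 1)\<close> are distinct elements of \<open>\<lambda>\<^sub>i \<inter> \<lambda>\<^bsub>i+1\<^esub>\<close>, since these could be swapped.
  Conversely, this local condition suffices: it allows one to build, one index at a time, a linear
  functional whose strict maximum on each \<open>\<lambda>\<^sub>i\<close> is at \<open>f i\<close>. Writing \<open>f i = s i + u\<^sub>i\<close>, the condition
  says exactly that \<open>u\<^sub>0, u\<^sub>1, \<dots>\<close> is a walk in \<open>D\<^bsub>k,s\<^esub>\<close>, and walks are counted by powers of the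
  adjacency matrix. The rational form is Cramer's rule for the inverse of \<open>I - xA\<close>.
\<close>

section \<open>Extreme points of convex hulls and Minkowski sums\<close>

lemma extreme_point_of_strict_max:
  fixes L :: "'a::real_vector \<Rightarrow> real"
  assumes "linear L" "v \<in> S" and lt: "\<And>y. y \<in> S \<Longrightarrow> y \<noteq> v \<Longrightarrow> L y < L v"
  shows "v extreme_point_of S"
  unfolding extreme_point_of_def
proof (intro conjI ballI notI)
  fix a b assume ab: "a \<in> S" "b \<in> S" "v \<in> open_segment a b"
  then obtain u where u: "0 < u" "u < 1" "v = (1 - u) *\<^sub>R a + u *\<^sub>R b" "a \<noteq> b"
    by (auto simp: in_segment)
  have "v \<noteq> a" "v \<noteq> b"
    using ab(3) by (auto simp: open_segment_def)
  then have "L a < L v" "L b < L v"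
    using ab lt by auto
  then have "(1 - u) * L a + u * L b < (1 - u) * L v + u * L v"
    using u by (intro add_strict_mono mult_strict_left_mono) auto
  moreover have "L v = (1 - u) * L a + u * L b"
    using \<open>linear L\<close> u(3) by (simp add: linear_add linear_scale)
  ultimately show False
    by (simp add: algebra_simps)
qed fact

text \<open>The point \<open>v\<close> together with the open half-space \<open>L x < L v\<close> is
  a convex set containing \<open>S\<close>, so it contains the hull.\<close>

lemma convex_hull_strict_max:
  fixes L :: "'a::real_vector \<Rightarrow> real"
  assumes "linear L" and lt: "\<And>y. y \<in> S \<Longrightarrow> y \<noteq> v \<Longrightarrow> L y < L v"
    and x: "x \<in> convex hull S" "x \<noteq> v"
  shows "L x < L v"
proof -
  let ?T = "{x. x = v \<or> L x < L v}"
  have "convex ?T"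
  proof (rule convexI)
    fix a b and u t :: real
    assume a: "a \<in> ?T" and b: "b \<in> ?T" and ut: "0 \<le> u" "0 \<le> t" "u + t = 1"
    have L: "L (u *\<^sub>R a + t *\<^sub>R b) = u * L a + t * L b"
      using \<open>linear L\<close> by (simp add: linear_add linear_scale)
    have t: "t = 1 - u"
      using ut by simp
    have le: "L a \<le> L v" "L b \<le> L v"
      using a b by auto
    consider "u = 0" | "t = 0" | "a = v" "b = v" | "0 < u" "0 < t" "L a < L v \<or> L b < L v"
      using a b ut by fastforce
    then show "u *\<^sub>R a + t *\<^sub>R b \<in> ?T"
    proof cases
      case 1 then show ?thesis using b ut by simp
    next
      case 2 then show ?thesis using a ut by simp
    next
      case 3 then show ?thesis using ut by (simp flip: scaleR_add_left)
    next
      case 4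
      then have "u * L a + t * L b < u * L v + t * L v"
        using le by (metis add_le_less_mono add_less_le_mono less_eq_real_def mult_left_mono
            mult_strict_left_mono)
      also have "\<dots> = L v"
        by (simp add: t algebra_simps)
      finally show ?thesis using L by simp
    qed
  qed
  moreover have "S \<subseteq> ?T"
    using lt by auto
  ultimately have "convex hull S \<subseteq> ?T"
    by (rule hull_minimal[rotated])
  with x show ?thesis by auto
qed

text \<open>Translation by the sum of the other summands carries a segment around \<open>x i\<close>
  in \<open>S i\<close> to a segment around the total inside the Minkowski sum.\<close>

lemma extreme_point_of_set_sum_perturb:
  fixes S :: "'i \<Rightarrow> 'a::real_vector set"
  assumes fin: "finite I" and v: "(\<Sum>i\<in>I. x i) extreme_point_of (\<Sum>i\<in>I. S i)"
    and x: "\<And>i. i \<in> I \<Longrightarrow> x i \<in> S i" and i: "i \<in> I" and ab: "a \<in> S i" "b \<in> S i"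
  shows "x i \<notin> open_segment a b"
proof
  assume seg: "x i \<in> open_segment a b"
  define r where "r = (\<Sum>j\<in>I - {i}. x j)"
  have eq: "(\<Sum>j\<in>I. (x(i := c)) j) = r + c" for c
    using fin i by (simp add: sum.remove[of I i] r_def add.commute)
  have mem: "r + c \<in> (\<Sum>i\<in>I. S i)" if "c \<in> S i" for c
    unfolding eq[symmetric] set_sum_alt[OF fin] using x that by fastforce
  have "(\<Sum>j\<in>I. x j) = r + x i"
    using eq[of "x i"] by simp
  then have "(\<Sum>j\<in>I. x j) \<in> open_segment (r + a) (r + b)"
    using seg by simp
  then show False
    using v mem ab by (auto simp: extreme_point_of_def)
qed

lemma extreme_point_of_summand:
  fixes S :: "'i \<Rightarrow> 'a::real_vector set"
  assumes "finite I" "(\<Sum>i\<in>I. x i) extreme_point_of (\<Sum>i\<in>I. S i)"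
    and "\<And>i. i \<in> I \<Longrightarrow> x i \<in> S i" "i \<in> I"
  shows "x i extreme_point_of S i"
  using extreme_point_of_set_sum_perturb[OF assms(1,2)] assms(3,4)
  unfolding extreme_point_of_def by blast

text \<open>With \<open>d = y i - x i\<close>, exchanging the \<open>i\<close>-th summand in one
  decomposition gives \<open>v + d\<close>, and the opposite exchange in the other gives
  \<open>v - d\<close>. Both lie in the Minkowski sum and \<open>v\<close> is their
  midpoint.\<close>

lemma extreme_point_of_set_sum_unique:
  fixes S :: "'i \<Rightarrow> 'a::real_vector set"
  assumes fin: "finite I" and v: "(\<Sum>i\<in>I. x i) extreme_point_of (\<Sum>i\<in>I. S i)"
    and x: "\<And>i. i \<in> I \<Longrightarrow> x i \<in> S i" and y: "\<And>i. i \<in> I \<Longrightarrow> y i \<in> S i"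
    and eq: "(\<Sum>i\<in>I. y i) = (\<Sum>i\<in>I. x i)" and i: "i \<in> I"
  shows "y i = x i"
proof (rule ccontr)
  assume ne: "y i \<noteq> x i"
  define v where "v = (\<Sum>i\<in>I. x i)"
  define d where "d = y i - x i"
  have mem: "sum z I \<in> (\<Sum>i\<in>I. S i)" if "\<And>i. i \<in> I \<Longrightarrow> z i \<in> S i" for z
    using that by (auto simp: set_sum_alt[OF fin])
  have "(\<Sum>j\<in>I. (x(i := y i)) j) = v + d"
    using fin i by (simp add: sum.remove[of I i] d_def v_def)
  moreover have "sum (x(i := y i)) I \<in> (\<Sum>i\<in>I. S i)"
    by (rule mem) (use x y in auto)
  ultimately have a: "v + d \<in> (\<Sum>i\<in>I. S i)"
    by simp
  have "(\<Sum>j\<in>I. (y(i := x i)) j) = sum y I - d"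
    using fin i by (simp add: sum.remove[of I i] d_def)
  moreover have "sum (y(i := x i)) I \<in> (\<Sum>i\<in>I. S i)"
    by (rule mem) (use x y in auto)
  ultimately have b: "v - d \<in> (\<Sum>i\<in>I. S i)"
    using eq by (simp add: v_def)
  have "d \<noteq> 0"
    using ne by (simp add: d_def)
  then have "2 *\<^sub>R d \<noteq> 0"
    by simp
  then have "v + d \<noteq> v - d"
    by (simp add: scaleR_2 eq_diff_eq add.assoc)
  moreover have "v = (1 - 1/2) *\<^sub>R (v + d) + (1/2) *\<^sub>R (v - d)"
    by (simp add: algebra_simps flip: scaleR_add_left)
  ultimately have "v \<in> open_segment (v + d) (v - d)"
    unfolding in_segment by (intro conjI exI[of _ "1/2"]) auto
  with a b assms(2) show False
    by (auto simp: extreme_point_of_def v_def)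
qed

lemma lookup_scaleR:
  fixes x :: "'a \<Rightarrow>\<^sub>0 'b::real_vector"
  shows "Poly_Mapping.lookup (u *\<^sub>R x) j = u *\<^sub>R Poly_Mapping.lookup x j"
proof -
  have "finite {i. u *\<^sub>R Poly_Mapping.lookup x i \<noteq> 0}"
    by (rule finite_subset[OF _ finite_keys[of x]]) (auto simp: in_keys_iff)
  then show ?thesis
    by (simp add: scaleR_poly_mapping_def)
qed

lemma e_vec_inject [simp]: "e_vec i = e_vec j \<longleftrightarrow> i = j"
  unfolding e_vec_def by (metis lookup_single_eq lookup_single_not_eq zero_neq_one)

lemma mem_lam [simp]: "j \<in> lam k s i \<longleftrightarrow> s * i \<le> j \<and> j < s * i + k"
  by (simp add: lam_def)

section \<open>Admissible choices of basis vectors and the vertices of the polytope\<close>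

definition admissible :: "nat \<Rightarrow> nat \<Rightarrow> nat \<Rightarrow> (nat \<Rightarrow> nat) \<Rightarrow> bool" where
  "admissible k s n f \<longleftrightarrow> (\<forall>i\<le>n. f i \<in> lam k s i) \<and>
     (\<forall>i<n. f i \<in> lam k s (Suc i) \<longrightarrow> f (Suc i) \<in> lam k s i \<longrightarrow> f (Suc i) = f i)"

text \<open>A descent \<open>f (Suc m) < f m\<close> would squeeze both values into the overlap of
  the two consecutive intervals, where admissibility makes them equal.\<close>

lemma admissible_mono:
  assumes "admissible k s n f" "i \<le> j" "j \<le> n"
  shows "f i \<le> f j"
  using assms(2,3)
proof (induction rule: dec_induct)
  case (step m)
  have "f m \<le> f (Suc m)"
  proof (rule ccontr)
    assume less: "\<not> f m \<le> f (Suc m)"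
    have "f m \<in> lam k s m" "f (Suc m) \<in> lam k s (Suc m)"
      using assms(1) step by (auto simp: admissible_def simp del: mem_lam)
    then have "f m \<in> lam k s (Suc m)" "f (Suc m) \<in> lam k s m"
      using less by auto
    moreover have "m < n"
      using step by simp
    ultimately have "f (Suc m) = f m"
      using assms(1) unfolding admissible_def by blast
    with less show False by simp
  qed
  with step show ?case by simp
qed simp

lemma admissible_weight:
  assumes "admissible k s n f"
  shows "\<exists>w :: nat \<Rightarrow> real. \<forall>i\<le>n. \<forall>j\<in>lam k s i. j \<noteq> f i \<longrightarrow> w j < w (f i)"
  using assms
proof (induction n)
  case 0
  show ?case
    by (intro exI[of _ "\<lambda>j. if j = f 0 then 1 else 0"]) auto
next
  case (Suc n)
  then have ch: "admissible k s n f" by (simp add: admissible_def)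
  then obtain w :: "nat \<Rightarrow> real" where
    w: "\<And>i j. i \<le> n \<Longrightarrow> j \<in> lam k s i \<Longrightarrow> j \<noteq> f i \<Longrightarrow> w j < w (f i)"
    using Suc.IH by blast
  have f: "f i \<in> lam k s i" if "i \<le> Suc n" for i
    using Suc.prems that by (simp add: admissible_def)
  have below: "s * i \<le> s * n" if "i \<le> n" for i
    using that by simp
  \<comment> \<open>The range covers every interval up to index \<open>Suc n\<close>; adding 1 makes
    \<open>M\<close> and \<open>- M\<close> lie strictly beyond all old weights there.\<close>
  define M where "M = Max ((\<lambda>j. \<bar>w j\<bar>) ` {..s * Suc n + k}) + 1"
  have M: "\<bar>w j\<bar> < M" if "j \<le> s * Suc n + k" for j
  proof -
    have "\<bar>w j\<bar> \<le> Max ((\<lambda>j. \<bar>w j\<bar>) ` {..s * Suc n + k})"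
      by (rule Max_ge) (use that in auto)
    then show ?thesis by (simp add: M_def)
  qed
  have last: "f n \<in> lam k s (Suc n) \<Longrightarrow> f (Suc n) \<in> lam k s n \<Longrightarrow> f (Suc n) = f n"
    using Suc.prems by (simp add: admissible_def del: mem_lam)
  txt \<open>
    In the three cases the new points get the largest weight, get the smallest weight, or get small
    weights together with the old points of \<open>\<lambda>\<^bsub>n+1\<^esub>\<close>; by monotonicity the values \<open>f i\<close> with
    \<open>i \<le> n\<close> are not affected.
  \<close>
  consider "f (Suc n) \<notin> lam k s n" | "f (Suc n) = f n" | "f n \<notin> lam k s (Suc n)" "f (Suc n) \<in> lam k s n"
    using last by blast
  then show ?case
  proof cases
    case 1
    \<comment> \<open>Missing \<open>lam k s n\<close> can only mean lying to its right, hence to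
      the right of all earlier intervals, where a changed weight does no harm.\<close>
    then have big: "s * n + k \<le> f (Suc n)"
      using f[of "Suc n"] by auto
    show ?thesis
    proof (intro exI[of _ "w(f (Suc n) := M)"] allI impI ballI)
      fix i j assume ij: "i \<le> Suc n" "j \<in> lam k s i" "j \<noteq> f i"
      show "(w(f (Suc n) := M)) j < (w(f (Suc n) := M)) (f i)"
      proof (cases "i = Suc n")
        case True
        then show ?thesis using ij M[of j] by auto
      next
        case False
        then have "i \<le> n" using ij by simp
        then have "j < f (Suc n)" "f i < f (Suc n)"
          using big below[OF \<open>i \<le> n\<close>] ij(2) f[OF ij(1)] unfolding mem_lam by linarith+
        then show ?thesis using w[of i j] ij \<open>i \<le> n\<close> by simp
      qed
    qed
  next
    case 2
    \<comment> \<open>The points of the new interval below \<open>s * n + k\<close> already belong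
      to \<open>lam k s n\<close>, so \<open>f n\<close> beats them by the induction
      hypothesis.\<close>
    let ?w = "\<lambda>j. if j < s * n + k then w j else - M"
    show ?thesis
    proof (intro exI[of _ ?w] allI impI ballI)
      fix i j assume ij: "i \<le> Suc n" "j \<in> lam k s i" "j \<noteq> f i"
      have fn: "f n < s * n + k" using f[of n] by simp
      show "?w j < ?w (f i)"
      proof (cases "i = Suc n")
        case True
        have "- M < w (f n)" using M[of "f n"] fn by auto
        moreover have "w j < w (f n)" if "j < s * n + k"
          using that w[of n j] ij True 2 by auto
        ultimately show ?thesis using True 2 fn by auto
      next
        case False
        then have "i \<le> n" using ij by simp
        then have "j < s * n + k" "f i < s * n + k"
          using below[OF \<open>i \<le> n\<close>] ij(2) f[OF ij(1)] unfolding mem_lam by linarith+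
        then show ?thesis using w[of i j] ij \<open>i \<le> n\<close> by simp
      qed
    qed
  next
    case 3
    have fn: "f n < s * Suc n"
      using f[of n] 3 by auto
    have old: "f i < s * Suc n" if "i \<le> n" for i
      using admissible_mono[OF ch that] fn by simp
    have new: "s * Suc n \<le> f (Suc n)"
      using f[of "Suc n"] by simp
    \<comment> \<open>The whole new interval starts at \<open>s * Suc n\<close>, so
      \<open>- M\<close> wins there, while each earlier \<open>f i\<close> lies below
      \<open>s * Suc n\<close> and keeps a weight above \<open>- M\<close>.\<close>
    let ?w = "\<lambda>j. if j < s * Suc n then w j else if j = f (Suc n) then - M else - M - 1"
    show ?thesis
    proof (intro exI[of _ ?w] allI impI ballI)
      fix i j assume ij: "i \<le> Suc n" "j \<in> lam k s i" "j \<noteq> f i"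
      show "?w j < ?w (f i)"
      proof (cases "i = Suc n")
        case True
        then show ?thesis using ij new by auto
      next
        case False
        then have i: "i \<le> n" using ij by simp
        have "- M < w (f i)" using M[of "f i"] old[OF i] by auto
        then show ?thesis using w[of i j] ij i old[OF i] by auto
      qed
    qed
  qed
qed

text \<open>A functional with a unique maximiser on each summand is maximised on the Minkowski sum
  only at the sum of these maximisers.\<close>

lemma admissible_sum_extreme:
  assumes "admissible k s n f"
  shows "(\<Sum>i<Suc n. e_vec (f i)) extreme_point_of P_poly (Suc n) k s"
proof -
  obtain w :: "nat \<Rightarrow> real" where
    w: "\<And>i j. i \<le> n \<Longrightarrow> j \<in> lam k s i \<Longrightarrow> j \<noteq> f i \<Longrightarrow> w j < w (f i)"
    using admissible_weight[OF assms] by blast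
  have f: "f i \<in> lam k s i" if "i \<le> n" for i
    using assms that by (simp add: admissible_def)
  \<comment> \<open>The cutoff \<open>s * n + k\<close> is the ambient dimension for
    \<open>Suc n\<close> summands, so no coordinate of the polytope is lost.\<close>
  define L where "L x = (\<Sum>j<s * n + k. w j * Poly_Mapping.lookup x j)" for x :: "nat \<Rightarrow>\<^sub>0 real"
  have L: "linear L"
    by (rule linearI)
      (simp_all add: L_def lookup_add lookup_scaleR algebra_simps sum.distrib sum_distrib_left)
  have Le: "L (e_vec j) = w j" if "i \<le> n" "j \<in> lam k s i" for i j
  proof -
    have "s * i \<le> s * n" using that by simp
    then have "j < s * n + k" using that unfolding mem_lam by linarith
    then show ?thesis
      by (simp add: L_def e_vec_def lookup_single when_def if_distrib cong: if_cong)
  qed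
  have max: "L x < L (e_vec (f i))" if "i \<le> n" "x \<in> simplex_on (lam k s i)" "x \<noteq> e_vec (f i)" for i x
    using that(2,3) unfolding simplex_on_def
    by (rule convex_hull_strict_max[OF L, rotated])
      (use that(1) w f Le in \<open>auto simp del: mem_lam\<close>)
  have e: "e_vec (f i) \<in> simplex_on (lam k s i)" if "i \<le> n" for i
    using f[OF that] unfolding simplex_on_def by (auto intro!: hull_inc simp del: mem_lam)
  show ?thesis
  proof (rule extreme_point_of_strict_max[OF L])
    show "(\<Sum>i<Suc n. e_vec (f i)) \<in> P_poly (Suc n) k s"
      unfolding P_poly_def set_sum_alt[OF finite_lessThan] using e by force
  next
    fix y assume y: "y \<in> P_poly (Suc n) k s" "y \<noteq> (\<Sum>i<Suc n. e_vec (f i))"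
    obtain z where z: "y = (\<Sum>i<Suc n. z i)" "\<And>i. i < Suc n \<Longrightarrow> z i \<in> simplex_on (lam k s i)"
      using y(1) unfolding P_poly_def set_sum_alt[OF finite_lessThan] by blast
    obtain i where i: "i < Suc n" "z i \<noteq> e_vec (f i)"
      using y(2) z(1) by (metis lessThan_iff sum.cong)
    have "(\<Sum>i<Suc n. L (z i)) < (\<Sum>i<Suc n. L (e_vec (f i)))"
    proof (rule sum_strict_mono_ex1)
      show "\<forall>i\<in>{..<Suc n}. L (z i) \<le> L (e_vec (f i))"
        using max z(2) by (metis lessThan_iff less_Suc_eq_le less_eq_real_def)
      show "\<exists>i\<in>{..<Suc n}. L (z i) < L (e_vec (f i))"
        using i max z(2) by (auto intro!: bexI[of _ i])
    qed simp
    then show "L y < L (\<Sum>i<Suc n. e_vec (f i))"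
      by (simp only: z(1) linear_sum[OF L])
  qed
qed

lemma extreme_point_of_P_polyE:
  assumes v: "v extreme_point_of P_poly (Suc n) k s"
  obtains f where "admissible k s n f" "v = (\<Sum>i<Suc n. e_vec (f i))"
proof -
  obtain x where x: "v = sum x {..<Suc n}" "\<And>i. i \<in> {..<Suc n} \<Longrightarrow> x i \<in> simplex_on (lam k s i)"
    using v unfolding extreme_point_of_def P_poly_def set_sum_alt[OF finite_lessThan] by blast
  have ext: "sum x {..<Suc n} extreme_point_of (\<Sum>i<Suc n. simplex_on (lam k s i))"
    using v x(1) by (simp add: P_poly_def)
  have "x i extreme_point_of simplex_on (lam k s i)" if "i \<in> {..<Suc n}" for i
    by (rule extreme_point_of_summand[OF _ ext x(2)]) (use that in auto)
  then have "\<forall>i\<in>{..<Suc n}. \<exists>j. j \<in> lam k s i \<and> x i = e_vec j"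
    unfolding simplex_on_def by (blast dest: extreme_point_of_convex_hull)
  then obtain f where f: "\<And>i. i \<in> {..<Suc n} \<Longrightarrow> f i \<in> lam k s i \<and> x i = e_vec (f i)"
    by metis
  have "admissible k s n f"
    unfolding admissible_def
  proof (intro conjI allI impI)
    fix i assume "i \<le> n"
    then show "f i \<in> lam k s i" using f by auto
  next
    fix i assume i: "i < n" "f i \<in> lam k s (Suc i)" "f (Suc i) \<in> lam k s i"
    \<comment> \<open>Both basis vectors lie in both simplices, so exchanging them gives another
      valid decomposition with the same sum; uniqueness then forces them to agree.\<close>
    let ?y = "x(i := x (Suc i), Suc i := x i)"
    have "(?y \<circ> Transposition.transpose i (Suc i)) = x"
      by (auto simp: fun_eq_iff Transposition.transpose_def)
    moreover have "sum (?y \<circ> Transposition.transpose i (Suc i)) {..<Suc n} = sum ?y {..<Suc n}"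
      by (rule sum.permute[symmetric]) (use i in \<open>auto intro!: permutes_swap_id\<close>)
    ultimately have eq: "sum ?y {..<Suc n} = sum x {..<Suc n}"
      by simp
    have "?y i = x i"
    proof (rule extreme_point_of_set_sum_unique[OF _ ext x(2) _ eq])
      fix l assume "l \<in> {..<Suc n}"
      then show "?y l \<in> simplex_on (lam k s l)"
        using x(2)[of l] i f[of i] f[of "Suc i"]
        by (auto simp: simplex_on_def intro!: hull_inc imageI simp del: mem_lam)
    qed (use i in auto)
    then show "f (Suc i) = f i"
      using f[of i] f[of "Suc i"] i(1) by simp
  qed
  moreover have "v = (\<Sum>i<Suc n. e_vec (f i))"
    unfolding x(1) using f by (intro sum.cong) auto
  ultimately show ?thesis using that by blast
qed

text \<open>Both sums decompose the same extreme point, so their summands agree.\<close>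

lemma admissible_sum_inject:
  assumes f: "admissible k s n f" and g: "admissible k s n g" and i: "i \<le> n"
    and eq: "(\<Sum>i<Suc n. e_vec (f i)) = (\<Sum>i<Suc n. e_vec (g i))"
  shows "f i = g i"
proof -
  have mem: "e_vec (h i) \<in> simplex_on (lam k s i)" if "admissible k s n h" "i \<in> {..<Suc n}" for h i
    using that unfolding simplex_on_def admissible_def
    by (auto intro!: hull_inc imageI simp del: mem_lam)
  have "e_vec (f i) = e_vec (g i)"
    by (rule extreme_point_of_set_sum_unique
        [OF finite_lessThan admissible_sum_extreme[OF g, unfolded P_poly_def] mem[OF g] mem[OF f] eq])
      (use i in auto)
  then show ?thesis by simp
qed

section \<open>Vertices of the polytope as walks in the digraph\<close>

definition walks :: "nat \<Rightarrow> nat \<Rightarrow> nat \<Rightarrow> nat list set" where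
  "walks k s n = {u. length u = Suc n \<and> set u \<subseteq> {..<k} \<and>
     (\<forall>i<n. (u ! i, u ! Suc i) \<in> parcs (D_graph k s))}"

text \<open>In a removed arc \<open>i'\<close> must be \<open>u - s\<close>, and the bound
  \<open>u - s < k - s\<close> already follows from \<open>s \<le> u\<close> and
  \<open>u < k\<close>.\<close>

lemma parcs_D_graph:
  "(u, v) \<in> parcs (D_graph k s) \<longleftrightarrow>
     u < k \<and> v < k \<and> (s \<le> u \<longrightarrow> v < k - s \<longrightarrow> u = s + v)"
proof -
  have "(\<exists>i j. u = s + i \<and> v = j \<and> i < k - s \<and> j < k - s \<and> i \<noteq> j) \<longleftrightarrow>
      s \<le> u \<and> u - s < k - s \<and> v < k - s \<and> u \<noteq> s + v"
    by (auto intro: exI[of _ "u - s"])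
  then show ?thesis
    by (auto simp: D_graph_def)
qed

text \<open>For entries below \<open>k\<close>, the shifted value at \<open>i\<close> lies in the
  next interval iff \<open>s \<le> u ! i\<close>, the one at \<open>Suc i\<close> lies in the
  previous interval iff \<open>u ! Suc i < k - s\<close>, and they coincide iff
  \<open>u ! i = s + u ! Suc i\<close>. This is the arc condition of
  \<open>parcs_D_graph\<close>.\<close>

lemma admissible_iff_walk:
  assumes "s < k" "length u = Suc n"
  shows "admissible k s n (\<lambda>i. s * i + u ! i) \<longleftrightarrow> u \<in> walks k s n"
proof -
  have set: "(\<forall>i\<le>n. u ! i < k) \<longleftrightarrow> set u \<subseteq> {..<k}"
    using assms(2) by (auto simp: subset_iff in_set_conv_nth less_Suc_eq_le)
  have arc: "(s * i + u ! i \<in> lam k s (Suc i) \<longrightarrow> s * Suc i + u ! Suc i \<in> lam k s i \<longrightarrow>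
        s * Suc i + u ! Suc i = s * i + u ! i) \<longleftrightarrow>
      (u ! i, u ! Suc i) \<in> parcs (D_graph k s)"
    if "u ! i < k" "u ! Suc i < k" for i
    using that assms(1) by (auto simp: parcs_D_graph)
  show ?thesis
  proof (cases "\<forall>i\<le>n. u ! i < k")
    case True
    have "(\<forall>i\<le>n. s * i + u ! i \<in> lam k s i) \<longleftrightarrow> True"
      using True by simp
    then show ?thesis
      using True assms(2) set
      by (simp add: admissible_def walks_def arc Suc_le_eq del: mult_Suc_right mem_lam)
  next
    case False
    then show ?thesis
      using set by (auto simp: admissible_def walks_def)
  qed
qed

lemma finite_walks [simp]: "finite (walks k s n)"
  by (rule finite_subset[OF _ finite_lists_length_eq[of "{..<k}" "Suc n"]]) (auto simp: walks_def)

lemma num_vertices_eq_card_walks: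
  assumes "s < k"
  shows "num_vertices k s (Suc n) = card (walks k s n)"
proof -
  let ?p = "\<lambda>u. \<Sum>i<Suc n. e_vec (s * i + u ! i)"
  have len: "length u = Suc n" if "u \<in> walks k s n" for u
    using that by (simp add: walks_def)
  have "bij_betw ?p (walks k s n) {v. v extreme_point_of P_poly (Suc n) k s}"
    unfolding bij_betw_def
  proof (intro conjI inj_onI equalityI subsetI)
    fix u t assume ut: "u \<in> walks k s n" "t \<in> walks k s n" "?p u = ?p t"
    then have "s * i + u ! i = s * i + t ! i" if "i \<le> n" for i
      using admissible_sum_inject[OF _ _ that ut(3)] admissible_iff_walk[OF assms len] by blast
    then show "u = t"
      using len[OF ut(1)] len[OF ut(2)] by (auto intro!: nth_equalityI)
  next
    fix v assume "v \<in> ?p ` walks k s n"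
    then show "v \<in> {v. v extreme_point_of P_poly (Suc n) k s}"
      using admissible_sum_extreme admissible_iff_walk[OF assms len] by blast
  next
    fix v assume "v \<in> {v. v extreme_point_of P_poly (Suc n) k s}"
    then obtain f where f: "admissible k s n f" "v = (\<Sum>i<Suc n. e_vec (f i))"
      using extreme_point_of_P_polyE by blast
    \<comment> \<open>The natural-number subtraction does not truncate, since \<open>f i\<close>
      lies in \<open>lam k s i\<close>.\<close>
    define u where "u = map (\<lambda>i. f i - s * i) [0..<Suc n]"
    have u: "s * i + u ! i = f i" if "i \<le> n" for i
    proof -
      have "f i \<in> lam k s i"
        using f(1) that by (simp add: admissible_def)
      then show ?thesis using that by (simp add: u_def del: upt_Suc)
    qed
    then have "admissible k s n (\<lambda>i. s * i + u ! i)"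
      using f(1) by (simp add: admissible_def u Suc_le_eq less_imp_le del: mem_lam mult_Suc_right)
    moreover have "length u = Suc n" by (simp add: u_def)
    ultimately have "u \<in> walks k s n"
      using admissible_iff_walk[OF assms] by blast
    moreover have "v = ?p u"
      unfolding f(2) using u by (intro sum.cong) auto
    ultimately show "v \<in> ?p ` walks k s n" by blast
  qed
  then show ?thesis
    by (simp add: num_vertices_def bij_betw_same_card)
qed

section \<open>Counting walks by powers of the adjacency matrix\<close>

lemma adjacency_carrier [simp]: "adjacency_mat k s \<in> carrier_mat k k"
  by (simp add: adjacency_mat_def)

text \<open>Splitting by the penultimate vertex \<open>l\<close> gives a disjoint union that mirrors
  right multiplication by the adjacency matrix.\<close>

lemma walks_last_Suc:
  "{u \<in> walks k s (Suc n). last u = j} =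
     (\<Union>l\<in>{l. l < k \<and> (l, j) \<in> parcs (D_graph k s)}. (\<lambda>u. u @ [j]) ` {u \<in> walks k s n. last u = l})"
  (is "?A = ?B")
proof (intro equalityI subsetI)
  fix u assume u: "u \<in> ?A"
  then have "u \<noteq> []" by (auto simp: walks_def)
  then obtain t where t: "u = t @ [j]"
    using u by (metis (mono_tags, lifting) append_butlast_last_id mem_Collect_eq)
  have arc: "(u ! i, u ! Suc i) \<in> parcs (D_graph k s)" if "i < Suc n" for i
    using u that by (simp add: walks_def)
  have len: "length t = Suc n" using u t by (simp add: walks_def)
  have "(t ! i, t ! Suc i) \<in> parcs (D_graph k s)" if "i < n" for i
    using arc[of i] that len by (simp add: t nth_append)
  then have "t \<in> walks k s n"
    using u len by (auto simp: walks_def t)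
  moreover have "last t = t ! n"
    using len by (metis diff_Suc_1 last_conv_nth length_0_conv nat.distinct(1))
  then have "(last t, j) \<in> parcs (D_graph k s)"
    using arc[of n] len by (simp add: t nth_append)
  ultimately show "u \<in> ?B"
    by (auto simp: t parcs_D_graph)
next
  fix u assume "u \<in> ?B"
  then obtain t where t: "t \<in> walks k s n" "u = t @ [j]" "(last t, j) \<in> parcs (D_graph k s)"
    by auto
  then have "last t = t ! n"
    by (metis (mono_tags, lifting) diff_Suc_1 last_conv_nth length_0_conv mem_Collect_eq nat.distinct(1) walks_def)
  with t have "(t ! n, j) \<in> parcs (D_graph k s)" "j < k"
    by (auto simp: parcs_D_graph)
  with t show "u \<in> ?A"
    by (auto simp: walks_def nth_append less_Suc_eq)
qed

text \<open>Column sums forget the starting vertex, so the induction tracks only the last one; one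
  more factor of the matrix appends one vertex.\<close>

lemma card_walks_last:
  assumes "j < k"
  shows "(\<Sum>i<k. (adjacency_mat k s ^\<^sub>m n) $$ (i, j)) = real (card {u \<in> walks k s n. last u = j})"
  using assms
proof (induction n arbitrary: j)
  case 0
  have "{u \<in> walks k s 0. last u = j} = {[j]}"
    using 0 by (auto simp: walks_def length_Suc_conv)
  moreover have "(\<Sum>i<k. (1\<^sub>m k :: real mat) $$ (i, j)) = (\<Sum>i<k. if i = j then 1 else 0)"
    using 0 by (intro sum.cong) auto
  ultimately show ?case
    using 0 by (simp add: adjacency_mat_def)
next
  case (Suc n)
  let ?A = "adjacency_mat k s" and ?E = "{l. l < k \<and> (l, j) \<in> parcs (D_graph k s)}"
  have pow: "?A ^\<^sub>m n \<in> carrier_mat k k" by simp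
  have "(\<Sum>i<k. (?A ^\<^sub>m Suc n) $$ (i, j)) =
      (\<Sum>i<k. \<Sum>l<k. (?A ^\<^sub>m n) $$ (i, l) * ?A $$ (l, j))"
    using Suc.prems pow adjacency_carrier[of k s]
    by (intro sum.cong)
      (auto simp: scalar_prod_def lessThan_atLeast0 simp del: adjacency_carrier intro!: sum.cong)
  also have "\<dots> = (\<Sum>l<k. (\<Sum>i<k. (?A ^\<^sub>m n) $$ (i, l)) * ?A $$ (l, j))"
    by (subst sum.swap) (simp add: sum_distrib_right)
  \<comment> \<open>The 0/1 entries of column \<open>j\<close> select the predecessors of
    \<open>j\<close>.\<close>
  also have "\<dots> = (\<Sum>l<k. if l \<in> ?E then real (card {u \<in> walks k s n. last u = l}) else 0)"
    using Suc by (intro sum.cong) (auto simp: adjacency_mat_def)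
  also have "\<dots> = (\<Sum>l\<in>?E. real (card {u \<in> walks k s n. last u = l}))"
    by (subst sum.inter_restrict[symmetric]) (auto intro!: sum.cong)
  also have "\<dots> = real (card {u \<in> walks k s (Suc n). last u = j})"
    unfolding walks_last_Suc
    by (subst card_UN_disjoint) (auto simp: card_image inj_on_def)
  finally show ?case .
qed

lemma sum_adjacency_pow:
  "(\<Sum>i<k. \<Sum>j<k. (adjacency_mat k s ^\<^sub>m n) $$ (i, j)) = real (card (walks k s n))"
proof -
  have "walks k s n = (\<Union>j<k. {u \<in> walks k s n. last u = j})"
    by (auto simp: walks_def) (metis last_in_set length_0_conv lessThan_iff nat.distinct(1) subsetD)
  then have "card (walks k s n) = card (\<Union>j<k. {u \<in> walks k s n. last u = j})"
    by simp
  also have "\<dots> = (\<Sum>j<k. card {u \<in> walks k s n. last u = j})"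
    by (intro card_UN_disjoint) auto
  finally show ?thesis
    by (subst sum.swap) (simp add: card_walks_last)
qed

section \<open>Generating function of the powers and Cramer's rule\<close>

text \<open>This transfers matrix products and determinants from polynomial entries to power series
  entries.\<close>

interpretation fps_of_poly_hom: comm_ring_hom "fps_of_poly :: 'a::comm_ring_1 poly \<Rightarrow> 'a fps"
  by unfold_locales (simp_all add: fps_of_poly_add fps_of_poly_mult)

text \<open>This is the geometric series of \<open>x A\<close>, stored entrywise, and plays the role
  of the inverse of \<open>I - x A\<close>.\<close>

definition pow_gf :: "'a::comm_ring_1 mat \<Rightarrow> 'a fps mat" where
  "pow_gf A = mat (dim_row A) (dim_row A) (\<lambda>(i, j). Abs_fps (\<lambda>n. (A ^\<^sub>m n) $$ (i, j)))"

lemma I_minus_xA_carrier [simp]: "I_minus_xA k s \<in> carrier_mat k k"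
  unfolding I_minus_xA_def by (intro minus_carrier_mat smult_carrier_mat) simp

text \<open>The coefficient of \<open>x^n\<close> in the product is
  \<open>A^n - A^(n-1) A = 0\<close> for positive \<open>n\<close>, which leaves only
  \<open>A^0 = I\<close>.\<close>

lemma pow_gf_mult:
  "pow_gf (adjacency_mat k s) * map_mat fps_of_poly (I_minus_xA k s) = 1\<^sub>m k" (is "?B * ?M = _")
proof (rule eq_matI)
  let ?A = "adjacency_mat k s"
  have dim: "dim_row ?A = k" "dim_col ?A = k"
    by (simp_all add: adjacency_mat_def)
  fix i j assume "i < dim_row (1\<^sub>m k :: real fps mat)" "j < dim_col (1\<^sub>m k :: real fps mat)"
  then have ij: "i < k" "j < k" by auto
  have M: "?M $$ (l, j) = (if l = j then 1 else 0) - fps_X * fps_const (?A $$ (l, j))" if "l < k" for l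
    using that ij
    by (simp add: I_minus_xA_def fps_of_poly_diff fps_of_poly_pCons fps_of_poly_mult dim)
  have "(?B * ?M) $$ (i, j) = (\<Sum>l<k. ?B $$ (i, l) * ?M $$ (l, j))"
    using ij by (simp add: scalar_prod_def lessThan_atLeast0 pow_gf_def I_minus_xA_def dim)
  also have "\<dots> = (\<Sum>l<k. (if l = j then ?B $$ (i, l) else 0) - fps_X * (?B $$ (i, l) * fps_const (?A $$ (l, j))))"
    by (intro sum.cong) (auto simp: M algebra_simps)
  also have "\<dots> = ?B $$ (i, j) - fps_X * (\<Sum>l<k. ?B $$ (i, l) * fps_const (?A $$ (l, j)))"
    using ij by (simp add: sum_subtractf sum_distrib_left)
  also have "\<dots> = 1\<^sub>m k $$ (i, j)"
  proof (rule fps_ext)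
    fix n
    have pow: "?A ^\<^sub>m m \<in> carrier_mat k k" for m by simp
    show "fps_nth (?B $$ (i, j) - fps_X * (\<Sum>l<k. ?B $$ (i, l) * fps_const (?A $$ (l, j)))) n =
        fps_nth (1\<^sub>m k $$ (i, j)) n"
    proof (cases n)
      case 0
      then show ?thesis using ij by (simp add: pow_gf_def dim)
    next
      case (Suc m)
      have "(?A ^\<^sub>m Suc m) $$ (i, j) = (\<Sum>l<k. (?A ^\<^sub>m m) $$ (i, l) * ?A $$ (l, j))"
        using ij pow[of m] by (simp add: scalar_prod_def lessThan_atLeast0 dim)
      with Suc show ?thesis
        using ij by (simp add: pow_gf_def dim fps_sum_nth)
    qed
  qed
  finally show "(?B * ?M) $$ (i, j) = 1\<^sub>m k $$ (i, j)" .
qed (simp_all add: pow_gf_def adjacency_mat_def I_minus_xA_def)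

text \<open>Cramer's rule with the denominator cleared: multiply
  \<open>M * adj_mat M = det M * I\<close> on the left by the left inverse of
  \<open>M = I - x A\<close>.\<close>

lemma pow_gf_adj:
  "fps_of_poly (Q_poly k s) \<cdot>\<^sub>m pow_gf (adjacency_mat k s) = map_mat fps_of_poly (adj_mat (I_minus_xA k s))"
proof -
  let ?B = "pow_gf (adjacency_mat k s)" and ?M = "I_minus_xA k s"
  have B: "?B \<in> carrier_mat k k" by (simp add: pow_gf_def adjacency_mat_def)
  note adj = adj_mat[OF I_minus_xA_carrier[of k s]]
  have M: "map_mat fps_of_poly ?M \<in> carrier_mat k k" and
    a: "map_mat fps_of_poly (adj_mat ?M) \<in> carrier_mat k k"
    using adj(1) by auto
  have "map_mat fps_of_poly (adj_mat ?M) = (?B * map_mat fps_of_poly ?M) * map_mat fps_of_poly (adj_mat ?M)"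
    unfolding pow_gf_mult using a by simp
  also have "\<dots> = ?B * map_mat fps_of_poly (?M * adj_mat ?M)"
    using assoc_mult_mat[OF B M a] fps_of_poly_hom.mat_hom_mult[OF I_minus_xA_carrier adj(1)] by simp
  also have "map_mat fps_of_poly (?M * adj_mat ?M) = fps_of_poly (Q_poly k s) \<cdot>\<^sub>m 1\<^sub>m k"
    unfolding adj(2) by (auto simp: Q_poly_def)
  also have "?B * \<dots> = fps_of_poly (Q_poly k s) \<cdot>\<^sub>m ?B"
    using B by (simp add: mult_smult_distrib[OF B one_carrier_mat])
  finally show ?thesis by simp
qed

text \<open>Taking determinants in \<open>pow_gf_mult\<close> exhibits the series of
  \<open>Q\<close> as a factor of 1.\<close>

lemma Q_poly_nonzero: "fps_of_poly (Q_poly k s) \<noteq> 0"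
proof -
  have "det (pow_gf (adjacency_mat k s)) * det (map_mat fps_of_poly (I_minus_xA k s)) =
      det (pow_gf (adjacency_mat k s) * map_mat fps_of_poly (I_minus_xA k s))"
    by (rule det_mult[of _ k, symmetric]) (auto simp: pow_gf_def adjacency_mat_def)
  also have "\<dots> = 1"
    by (simp add: pow_gf_mult)
  finally show ?thesis
    unfolding Q_poly_def fps_of_poly_hom.hom_det by auto
qed

theorem theorem4p6:
  fixes k s :: nat
  assumes "0 < s" and "s < k"
  shows "Abs_fps (\<lambda>n. real (num_vertices k s (n + 1))) =
           Abs_fps (\<lambda>n. \<Sum>i<k. \<Sum>j<k. (adjacency_mat k s ^\<^sub>m n) $$ (i, j))
       \<and> Abs_fps (\<lambda>n. \<Sum>i<k. \<Sum>j<k. (adjacency_mat k s ^\<^sub>m n) $$ (i, j)) =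
           fps_of_poly (\<Sum>i<k. \<Sum>j<k. (-1) ^ (i + j) * Q_minor k s i j)
             / fps_of_poly (Q_poly k s)"
proof
  show "Abs_fps (\<lambda>n. real (num_vertices k s (n + 1))) =
           Abs_fps (\<lambda>n. \<Sum>i<k. \<Sum>j<k. (adjacency_mat k s ^\<^sub>m n) $$ (i, j))"
    using assms(2) by (simp add: sum_adjacency_pow num_vertices_eq_card_walks)
next
  let ?G = "Abs_fps (\<lambda>n. \<Sum>i<k. \<Sum>j<k. (adjacency_mat k s ^\<^sub>m n) $$ (i, j))"
  let ?Q = "fps_of_poly (Q_poly k s)" and ?B = "pow_gf (adjacency_mat k s)"
  have entry: "?B $$ (i, j) * ?Q = fps_of_poly ((-1) ^ (i + j) * Q_minor k s i j)" if "i < k" "j < k" for i j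
  proof -
    have "?B $$ (i, j) * ?Q = (?Q \<cdot>\<^sub>m ?B) $$ (i, j)"
      using that by (simp add: pow_gf_def adjacency_mat_def)
    \<comment> \<open>Entry \<open>(i, j)\<close> of the adjugate is the cofactor at
      \<open>(j, i)\<close>, which matches the swapped indices in \<open>Q_minor\<close>.\<close>
    also have "\<dots> = fps_of_poly ((-1) ^ (i + j) * Q_minor k s i j)"
      using that carrier_matD[OF I_minus_xA_carrier[of k s]] unfolding pow_gf_adj
      by (simp add: adj_mat_def cofactor_def Q_minor_def add.commute)
    finally show ?thesis .
  qed
  have "?G = (\<Sum>i<k. \<Sum>j<k. ?B $$ (i, j))"
    by (rule fps_ext) (simp add: fps_sum_nth pow_gf_def adjacency_mat_def)
  then have GQ: "?G * ?Q = fps_of_poly (\<Sum>i<k. \<Sum>j<k. (-1) ^ (i + j) * Q_minor k s i j)"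
    by (simp add: sum_distrib_right entry fps_of_poly_sum)
  show "?G = fps_of_poly (\<Sum>i<k. \<Sum>j<k. (-1) ^ (i + j) * Q_minor k s i j) / ?Q"
    unfolding GQ[symmetric] by (rule nonzero_mult_div_cancel_right[OF Q_poly_nonzero, symmetric])
qed

end
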